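(* Let $K$ be a field of prime characteristic $p$ and let $\mathbf{x}=x_1,\dots,x_n$ be a sequence of $n\ge 1$ variables. Then $K[\![\mathbf{x}]\!]$ is a free module over its subring $(K[\![\mathbf{x}]\!])^p$ if and only if $[K:K^p]<\infty$.
   Context: $K[\![\mathbf{x}]\!]$ is the formal power series ring over $K$ in the commuting variables $x_1,\dots,x_n$. For a commutative ring $A$ of prime characteristic $p$, $A^p=\{a^p : a\in A\}$ denotes the subring of $p$th powers (the image of the Frobenius endomorphism); in particular $K^p=\{c^p : c\in K\}$ is a subfield of $K$. $K[\![\mathbf{x}]\!]$ is a module over $(K[\![\mathbf{x}]\!])^p$ via the inclusion of rings. *)

theory Defs
  imports
    "HOL-Library.FuncSet"
    "HOL-Computational_Algebra.Computational_Algebra"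
begin

section \<open>Formal power series in finitely many commuting variables\<close>

text \<open>
  The variables are indexed by the finite (and, like every type, nonempty) type \<open>'n\<close>.
  An exponent vector is a function \<open>'n \<Rightarrow> nat\<close>, and a power series is the family
  of its coefficients, indexed by all exponent vectors.
\<close>

typedef ('a, 'n) mfps = "UNIV :: (('n \<Rightarrow> nat) \<Rightarrow> 'a) set"
  morphisms mfps_coeff Abs_mfps
  by simp

setup_lifting type_definition_mfps

lemma mfps_eqI: "(\<And>m. mfps_coeff f m = mfps_coeff g m) \<Longrightarrow> f = g"
  by (simp add: mfps_coeff_inject [symmetric] fun_eq_iff)

definition exponent_splits :: "('n \<Rightarrow> nat) \<Rightarrow> (('n \<Rightarrow> nat) \<times> ('n \<Rightarrow> nat)) set" where
  "exponent_splits m = {(a, b). (\<lambda>i. a i + b i) = m}"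

lemma mem_exponent_splits [simp]: "(a, b) \<in> exponent_splits m \<longleftrightarrow> (\<lambda>i. a i + b i) = m"
  by (simp add: exponent_splits_def)

lemma finite_exponent_splits [simp]:
  fixes m :: "'n::finite \<Rightarrow> nat"
  shows "finite (exponent_splits m)"
proof (rule finite_subset)
  have "finite (PiE UNIV (\<lambda>i. {..m i}))"
    by (rule finite_PiE) auto
  then have "finite {a. a \<le> m}"
    by (simp add: PiE_def Pi_def le_fun_def)
  then show "finite ({a. a \<le> m} \<times> {b. b \<le> m})"
    by simp
  show "exponent_splits m \<subseteq> {a. a \<le> m} \<times> {b. b \<le> m}"
    by (auto simp: le_fun_def)
qed

instantiation mfps :: (comm_ring_1, finite) comm_ring_1
begin

lift_definition zero_mfps :: "('a, 'b) mfps" is "\<lambda>_. 0" .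

lift_definition one_mfps :: "('a, 'b) mfps" is "\<lambda>m. if m = (\<lambda>_. 0) then 1 else 0" .

lift_definition plus_mfps :: "('a, 'b) mfps \<Rightarrow> ('a, 'b) mfps \<Rightarrow> ('a, 'b) mfps"
  is "\<lambda>f g m. f m + g m" .

lift_definition minus_mfps :: "('a, 'b) mfps \<Rightarrow> ('a, 'b) mfps \<Rightarrow> ('a, 'b) mfps"
  is "\<lambda>f g m. f m - g m" .

lift_definition uminus_mfps :: "('a, 'b) mfps \<Rightarrow> ('a, 'b) mfps"
  is "\<lambda>f m. - f m" .

lift_definition times_mfps :: "('a, 'b) mfps \<Rightarrow> ('a, 'b) mfps \<Rightarrow> ('a, 'b) mfps"
  is "\<lambda>f g m. \<Sum>(a, b) \<in> exponent_splits m. f a * g b" .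

instance
proof
  fix f g h :: "('a, 'b) mfps"
  show "f * g * h = f * (g * h)"
  proof (rule mfps_eqI)
    fix m
    let ?f = "mfps_coeff f" and ?g = "mfps_coeff g" and ?h = "mfps_coeff h"
    have "mfps_coeff (f * g * h) m =
        (\<Sum>x\<in>exponent_splits m. \<Sum>y\<in>exponent_splits (fst x). ?f (fst y) * ?g (snd y) * ?h (snd x))"
      by (simp add: times_mfps.rep_eq case_prod_unfold sum_distrib_right)
    also have "\<dots> = (\<Sum>(x, y)\<in>Sigma (exponent_splits m) (\<lambda>x. exponent_splits (fst x)).
        ?f (fst y) * ?g (snd y) * ?h (snd x))"
      by (rule sum.Sigma) auto
    also have "\<dots> = (\<Sum>(x, y)\<in>Sigma (exponent_splits m) (\<lambda>x. exponent_splits (snd x)).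
        ?f (fst x) * (?g (fst y) * ?h (snd y)))"
      by (rule sum.reindex_bij_witness
            [where i = "\<lambda>((a, b), (c, d)). (((\<lambda>i. a i + c i), d), (a, c))"
              and j = "\<lambda>((a, b), (c, d)). ((c, (\<lambda>i. d i + b i)), (d, b))"])
         (auto simp: mult.assoc add.assoc)
    also have "\<dots> = (\<Sum>x\<in>exponent_splits m. \<Sum>y\<in>exponent_splits (snd x).
        ?f (fst x) * (?g (fst y) * ?h (snd y)))"
      by (rule sum.Sigma [symmetric]) auto
    also have "\<dots> = mfps_coeff (f * (g * h)) m"
      by (simp add: times_mfps.rep_eq case_prod_unfold sum_distrib_left)
    finally show "mfps_coeff (f * g * h) m = mfps_coeff (f * (g * h)) m" .
  qed
  show "f * g = g * f"
    by (rule mfps_eqI, unfold times_mfps.rep_eq)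
       (rule sum.reindex_bij_witness [where i = prod.swap and j = prod.swap],
        auto simp: add.commute mult.commute)
  show "1 * f = f"
  proof (rule mfps_eqI)
    fix m
    have "mfps_coeff (1 * f) m =
        (\<Sum>x\<in>exponent_splits m. if x = ((\<lambda>_. 0), m) then mfps_coeff f m else 0)"
      unfolding times_mfps.rep_eq one_mfps.rep_eq
      by (rule sum.cong) (auto split: if_splits)
    then show "mfps_coeff (1 * f) m = mfps_coeff f m"
      by simp
  qed
  show "(f + g) * h = f * h + g * h"
    by (rule mfps_eqI)
       (simp add: times_mfps.rep_eq plus_mfps.rep_eq case_prod_unfold distrib_right sum.distrib)
  show "f + g + h = f + (g + h)" "f + g = g + f" "0 + f = f" "- f + f = 0" "f - g = f + - g"
    by (rule mfps_eqI; simp add: plus_mfps.rep_eq minus_mfps.rep_eq uminus_mfps.rep_eq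
          zero_mfps.rep_eq algebra_simps)+
  have "mfps_coeff (0 :: ('a, 'b) mfps) (\<lambda>_. 0) \<noteq> mfps_coeff (1 :: ('a, 'b) mfps) (\<lambda>_. 0)"
    by (simp add: zero_mfps.rep_eq one_mfps.rep_eq)
  then show "(0 :: ('a, 'b) mfps) \<noteq> 1"
    by metis
qed

end

lemma mfps_coeff_of_nat:
  "mfps_coeff (of_nat k :: ('a::comm_ring_1, 'n::finite) mfps) m = (if m = (\<lambda>_. 0) then of_nat k else 0)"
  by (induction k) (simp_all add: zero_mfps.rep_eq one_mfps.rep_eq plus_mfps.rep_eq)

lemma CHAR_mfps [simp]: "CHAR(('a::comm_ring_1, 'n::finite) mfps) = CHAR('a)"
proof (rule CHAR_eqI)
  show "of_nat CHAR('a) = (0 :: ('a, 'n) mfps)"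
    by (rule mfps_eqI) (simp add: mfps_coeff_of_nat zero_mfps.rep_eq)
next
  fix k assume "of_nat k = (0 :: ('a, 'n) mfps)"
  then have "mfps_coeff (of_nat k :: ('a, 'n) mfps) (\<lambda>_. 0) = mfps_coeff (0 :: ('a, 'n) mfps) (\<lambda>_. 0)"
    by simp
  then show "CHAR('a) dvd k"
    by (simp add: mfps_coeff_of_nat zero_mfps.rep_eq of_nat_eq_0_iff_char_dvd)
qed

instance mfps :: (comm_ring_prime_char, finite) comm_ring_prime_char
proof
  show "\<exists>n. prime n \<and> of_nat n = (0 :: ('a, 'b) mfps)"
    by (rule exI [where x = "CHAR('a)"]) (metis CHAR_mfps CHAR_prime of_nat_CHAR)
qed

section \<open>The subring of \<open>p\<close>th powers\<close>

text \<open>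
  For a commutative ring \<open>'a\<close> of prime characteristic \<open>p\<close>, the type \<open>'a pth_power\<close> is the
  subring of \<open>p\<close>th powers of elements of \<open>'a\<close>, with inclusion map \<open>of_pth_power\<close>.  Making this
  subring a type allows it to serve as the scalars in the library theory of modules.
\<close>

typedef (overloaded) ('a::comm_ring_prime_char) pth_power = "range (\<lambda>a::'a. a ^ CHAR('a))"
  morphisms of_pth_power Abs_pth_power
  by blast

setup_lifting type_definition_pth_power

lemma uminus_power_CHAR: "(- a) ^ CHAR('a) = - (a ^ CHAR('a))" for a :: "'a::comm_ring_prime_char"
proof -
  have "a ^ CHAR('a) + (- a) ^ CHAR('a) = (a + (- a)) ^ CHAR('a)"
    by (rule freshmans_dream [symmetric]) auto
  also have "\<dots> = 0"
    by (simp add: power_0_left)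
  finally show ?thesis
    by (simp add: eq_neg_iff_add_eq_0 add.commute)
qed

instantiation pth_power :: (comm_ring_prime_char) comm_ring_1
begin

lift_definition zero_pth_power :: "'a pth_power" is 0
  by (rule range_eqI [where x = 0]) (simp add: power_0_left)

lift_definition one_pth_power :: "'a pth_power" is 1
  by (rule range_eqI [where x = 1]) simp

lift_definition plus_pth_power :: "'a pth_power \<Rightarrow> 'a pth_power \<Rightarrow> 'a pth_power" is "(+)"
  by (auto simp flip: freshmans_dream)

lift_definition uminus_pth_power :: "'a pth_power \<Rightarrow> 'a pth_power" is uminus
  by (auto simp flip: uminus_power_CHAR)

lift_definition minus_pth_power :: "'a pth_power \<Rightarrow> 'a pth_power \<Rightarrow> 'a pth_power" is "(-)"
  unfolding diff_conv_add_uminus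
  by (auto simp flip: uminus_power_CHAR freshmans_dream simp del: add_uminus_conv_diff)

lift_definition times_pth_power :: "'a pth_power \<Rightarrow> 'a pth_power \<Rightarrow> 'a pth_power" is "(*)"
  by (auto simp flip: power_mult_distrib)

instance
  by standard (transfer; simp add: algebra_simps)+

end

instantiation pth_power :: (field_prime_char) field
begin

lift_definition inverse_pth_power :: "'a pth_power \<Rightarrow> 'a pth_power" is inverse
  by (auto simp flip: power_inverse)

definition divide_pth_power :: "'a pth_power \<Rightarrow> 'a pth_power \<Rightarrow> 'a pth_power" where
  "divide_pth_power a b = a * inverse b"

instance
  by standard (transfer; simp add: divide_pth_power_def; fail | simp add: divide_pth_power_def)+

end

text \<open>The ring as a module over its \<open>p\<close>th powers, by restriction of multiplication.\<close>

definition pth_power_scale :: "'a::comm_ring_prime_char pth_power \<Rightarrow> 'a \<Rightarrow> 'a" where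
  "pth_power_scale c a = of_pth_power c * a"

lemma range_of_pth_power:
  "range (of_pth_power :: 'a::comm_ring_prime_char pth_power \<Rightarrow> 'a) = {a ^ CHAR('a) | a. True}"
  by (auto simp: type_definition.Rep_range [OF type_definition_pth_power])

lemma module_pth_power_scale:
  "module (pth_power_scale :: 'a::comm_ring_prime_char pth_power \<Rightarrow> 'a \<Rightarrow> 'a)"
  by unfold_locales
     (simp_all add: pth_power_scale_def plus_pth_power.rep_eq times_pth_power.rep_eq
        one_pth_power.rep_eq algebra_simps)

lemma vector_space_pth_power_scale:
  "vector_space (pth_power_scale :: 'a::field_prime_char pth_power \<Rightarrow> 'a \<Rightarrow> 'a)"
  by unfold_locales
     (simp_all add: pth_power_scale_def plus_pth_power.rep_eq times_pth_power.rep_eq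
        one_pth_power.rep_eq algebra_simps)

section \<open>Freeness and finite degree\<close>

definition free_module :: "('r::comm_ring_1 \<Rightarrow> 'm::ab_group_add \<Rightarrow> 'm) \<Rightarrow> bool" where
  "free_module scale \<longleftrightarrow>
     module scale \<and> (\<exists>B. \<not> module.dependent scale B \<and> module.span scale B = UNIV)"

text \<open>
  For \<open>scale = pth_power_scale\<close> on a field \<open>K\<close>, this says \<open>[K : K\<^sup>p] < \<infinity>\<close>.
\<close>

definition finite_dimensional :: "('k::field \<Rightarrow> 'v::ab_group_add \<Rightarrow> 'v) \<Rightarrow> bool" where
  "finite_dimensional scale \<longleftrightarrow> (\<exists>B. finite_dimensional_vector_space scale B)"

end

theory Submission
  imports Defs
begin

text \<open>
  If \<open>S\<close> is a finite basis of \<open>K\<close> over \<open>K\<^sup>p\<close>, then the products of the elements of \<open>S\<close> with the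
  monomials having all exponents below \<open>p\<close> form a basis of the power series ring \<open>A\<close> over \<open>A\<^sup>p\<close>:
  split every exponent into quotient and remainder modulo \<open>p\<close>.

  Conversely, let \<open>B\<close> be a basis of \<open>A\<close> over \<open>A\<^sup>p\<close>, and let \<open>t \<in> A\<^sup>p\<close> be the \<open>p\<close>th power of the
  product of all variables. If \<open>b\<^sub>0, b\<^sub>1, \<dots>\<close> were distinct elements of \<open>B\<close>, the series
  \<open>\<Sum>t\<^sup>i b\<^sub>i\<close> would converge in \<open>A\<close>, and its coordinate at \<open>b\<^sub>N\<close> would be of the form
  \<open>t\<^sup>N (1 + t s)\<close>, hence nonzero for every \<open>N\<close>; this is absurd. So \<open>B\<close> is finite, and the constant
  coefficients of its elements span \<open>K\<close> over \<open>K\<^sup>p\<close>.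
\<close>

section \<open>Coefficients and monomials\<close>

lemma mfps_coeff_sum: "mfps_coeff (sum f S) m = (\<Sum>s\<in>S. mfps_coeff (f s) m)"
  by (induction S rule: infinite_finite_induct) (simp_all add: zero_mfps.rep_eq plus_mfps.rep_eq)

lemma mfps_coeff_Abs [simp]: "mfps_coeff (Abs_mfps f) m = f m"
  by (simp add: Abs_mfps_inverse)

lemma mfps_coeff_mult_zero:
  fixes f g :: "('a::comm_ring_1, 'n::finite) mfps"
  shows "mfps_coeff (f * g) (\<lambda>_. 0) = mfps_coeff f (\<lambda>_. 0) * mfps_coeff g (\<lambda>_. 0)"
proof -
  have "exponent_splits (\<lambda>_::'n. 0) = {(\<lambda>_. 0, \<lambda>_. 0)}"
    by (auto simp: exponent_splits_def fun_eq_iff)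
  then show ?thesis
    by (simp add: times_mfps.rep_eq)
qed

lemma mfps_coeff_power_zero:
  fixes f :: "('a::comm_ring_1, 'n::finite) mfps"
  shows "mfps_coeff (f ^ k) (\<lambda>_. 0) = mfps_coeff f (\<lambda>_. 0) ^ k"
  by (induction k) (simp_all add: mfps_coeff_mult_zero one_mfps.rep_eq)

definition mfps_monom :: "'a::comm_ring_1 \<Rightarrow> ('n \<Rightarrow> nat) \<Rightarrow> ('a, 'n) mfps" where
  "mfps_monom c e = Abs_mfps (\<lambda>m. if m = e then c else 0)"

lemma mfps_coeff_monom: "mfps_coeff (mfps_monom c e) m = (if m = e then c else 0)"
  by (simp add: mfps_monom_def)

lemma mfps_coeff_monom_mult:
  fixes f :: "('a::comm_ring_1, 'n::finite) mfps"
  shows "mfps_coeff (mfps_monom c e * f) m = (if e \<le> m then c * mfps_coeff f (\<lambda>i. m i - e i) else 0)"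
proof -
  have "mfps_coeff (mfps_monom c e * f) m =
      (\<Sum>x\<in>exponent_splits m. if x = (e, \<lambda>i. m i - e i) then c * mfps_coeff f (\<lambda>i. m i - e i) else 0)"
    unfolding times_mfps.rep_eq by (rule sum.cong) (auto simp: mfps_coeff_monom split: if_splits)
  also have "\<dots> = (if e \<le> m then c * mfps_coeff f (\<lambda>i. m i - e i) else 0)"
    by (auto simp: sum.delta le_fun_def fun_eq_iff) (metis le_add1)
  finally show ?thesis .
qed

lemma mfps_monom_mult:
  "mfps_monom a d * mfps_monom b e =
    (mfps_monom (a * b) (\<lambda>i. d i + e i) :: ('a::comm_ring_1, 'n::finite) mfps)"
proof (rule mfps_eqI)
  fix m :: "'n \<Rightarrow> nat"
  have "d \<le> m \<and> (\<lambda>i. m i - d i) = e \<longleftrightarrow> m = (\<lambda>i. d i + e i)"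
    by (auto simp: fun_eq_iff le_fun_def) (metis le_add_diff_inverse)
  then show "mfps_coeff (mfps_monom a d * mfps_monom b e) m =
      mfps_coeff (mfps_monom (a * b) (\<lambda>i. d i + e i)) m"
    by (auto simp: mfps_coeff_monom_mult mfps_coeff_monom)
qed

lemma mfps_monom_power:
  "mfps_monom c e ^ k = (mfps_monom (c ^ k) (\<lambda>i. k * e i) :: ('a::comm_ring_1, 'n::finite) mfps)"
proof (induction k)
  case 0
  show ?case
    by (rule mfps_eqI) (simp add: mfps_coeff_monom one_mfps.rep_eq)
qed (simp add: mfps_monom_mult)

text \<open>Frobenius is additive only on finite sums, so \<open>f\<close> is cut down to the
  finitely many terms with exponent below \<open>m\<close>. The remainder \<open>h\<close> vanishes
  at every exponent \<open>\<le> m\<close>, and each splitting of \<open>m\<close> has such an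
  exponent as its first component, so \<open>h\<close> to the power \<open>p\<close> contributes
  nothing at \<open>m\<close>.\<close>

lemma mfps_coeff_power_CHAR:
  fixes f :: "('k::field_prime_char, 'n::finite) mfps"
  shows "mfps_coeff (f ^ CHAR('k)) m =
    (if \<forall>i. CHAR('k) dvd m i then mfps_coeff f (\<lambda>i. m i div CHAR('k)) ^ CHAR('k) else 0)"
proof -
  let ?p = "CHAR('k)"
  have p: "?p > 0" and prime: "prime ?p"
    by (auto intro: CHAR_prime prime_gt_0_nat)
  have "{e. e \<le> m} = (PiE UNIV (\<lambda>i. {..m i}))"
    by (auto simp: PiE_def Pi_def le_fun_def)
  then have fin: "finite {e. e \<le> m}"
    by (simp add: finite_PiE)
  define g where "g = (\<Sum>e | e \<le> m. mfps_monom (mfps_coeff f e) e)"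
  define h where "h = f - g"
  have h0: "mfps_coeff h e = 0" if "e \<le> m" for e
    using that fin by (simp add: h_def g_def minus_mfps.rep_eq mfps_coeff_sum mfps_coeff_monom)
  have "mfps_coeff (h ^ ?p) m = mfps_coeff (h * h ^ (?p - 1)) m"
    using p by (metis power_eq_if less_irrefl)
  also have "\<dots> = 0"
    unfolding times_mfps.rep_eq by (rule sum.neutral) (auto intro!: h0 simp: le_fun_def)
  finally have hp: "mfps_coeff (h ^ ?p) m = 0" .
  have "f ^ ?p = (g + h) ^ ?p"
    by (simp add: h_def)
  also have "\<dots> = g ^ ?p + h ^ ?p"
    by (rule freshmans_dream) (use prime in auto)
  also have "g ^ ?p = (\<Sum>e | e \<le> m. mfps_monom (mfps_coeff f e) e ^ ?p)"
    unfolding g_def by (rule freshmans_dream_sum) (use prime in auto)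
  finally have "mfps_coeff (f ^ ?p) m =
      (\<Sum>e | e \<le> m. if m = (\<lambda>i. ?p * e i) then mfps_coeff f e ^ ?p else 0)"
    by (simp add: plus_mfps.rep_eq hp mfps_coeff_sum mfps_monom_power mfps_coeff_monom)
  also have "\<dots> = (\<Sum>e | e \<le> m. if e = (\<lambda>i. m i div ?p) then
      (if \<forall>i. ?p dvd m i then mfps_coeff f e ^ ?p else 0) else 0)"
    using p by (intro sum.cong) (auto simp: fun_eq_iff)
  also have "\<dots> = (if \<forall>i. ?p dvd m i then mfps_coeff f (\<lambda>i. m i div ?p) ^ ?p else 0)"
    using fin by (simp add: sum.delta le_fun_def)
  finally show ?thesis .
qed

text \<open>By uniqueness of division with remainder, distinct reduced exponents \<open>e\<close>
  yield series supported on disjoint residue classes modulo \<open>p\<close>.\<close>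

lemma mfps_coeff_power_CHAR_mult_monom:
  fixes h :: "('k::field_prime_char, 'n::finite) mfps"
  assumes e: "\<And>i. e i < CHAR('k)"
  shows "mfps_coeff (h ^ CHAR('k) * mfps_monom c e) m =
    (if e = (\<lambda>i. m i mod CHAR('k)) then mfps_coeff h (\<lambda>i. m i div CHAR('k)) ^ CHAR('k) * c else 0)"
proof -
  let ?p = "CHAR('k)"
  have *: "e \<le> m \<and> (\<forall>i. ?p dvd m i - e i) \<longleftrightarrow> e = (\<lambda>i. m i mod ?p)"
  proof
    assume "e \<le> m \<and> (\<forall>i. ?p dvd m i - e i)"
    then have "m i mod ?p = e i mod ?p" for i
      by (metis le_fun_def mod_eq_dvd_iff_nat)
    then show "e = (\<lambda>i. m i mod ?p)"
      using e by (simp add: fun_eq_iff)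
  qed (auto simp: le_fun_def)
  have coeff: "mfps_coeff (h ^ ?p * mfps_monom c e) m =
      (if e \<le> m \<and> (\<forall>i. ?p dvd m i - e i)
       then mfps_coeff h (\<lambda>i. (m i - e i) div ?p) ^ ?p * c else 0)"
    by (subst mult.commute) (simp add: mfps_coeff_monom_mult mfps_coeff_power_CHAR mult.commute)
  show ?thesis
  proof (cases "e = (\<lambda>i. m i mod ?p)")
    case True
    then have "(m i - e i) div ?p = m i div ?p" for i
      using CHAR_pos[where 'a='k]
      by (simp add: minus_mod_eq_mult_div)
    with True show ?thesis
      unfolding coeff * by simp
  next
    case False
    then show ?thesis
      unfolding coeff * by simp
  qed
qed

section \<open>The scalars\<close>

lemma of_pth_power_power: "of_pth_power (c ^ k) = of_pth_power c ^ k"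
  by (induction k) (simp_all add: one_pth_power.rep_eq times_pth_power.rep_eq)

lift_definition pth_power_of :: "'a::comm_ring_prime_char \<Rightarrow> 'a pth_power" is "\<lambda>a. a ^ CHAR('a)"
  by blast

text \<open>Allows a family of scalars to be traded for a family of pth roots.\<close>

lemma pth_power_of_surj: "\<exists>a. c = pth_power_of a"
  by transfer auto

lemma pth_power_of_0 [simp]: "pth_power_of 0 = 0"
  by transfer (simp add: power_0_left)

section \<open>A basis of the power series ring from a finite basis of the field\<close>

lemma free_module_mfps_if_finite_dimensional:
  assumes "finite_dimensional (pth_power_scale :: 'k::field_prime_char pth_power \<Rightarrow> 'k \<Rightarrow> 'k)"
  shows "free_module (pth_power_scale ::
    ('k, 'n::finite) mfps pth_power \<Rightarrow> ('k, 'n) mfps \<Rightarrow> ('k, 'n) mfps)"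
proof -
  let ?p = "CHAR('k)"
  let ?s = "pth_power_scale :: 'k pth_power \<Rightarrow> 'k \<Rightarrow> 'k"
  let ?S = "pth_power_scale :: ('k, 'n) mfps pth_power \<Rightarrow> ('k, 'n) mfps \<Rightarrow> ('k, 'n) mfps"
  interpret K: vector_space ?s
    by (rule vector_space_pth_power_scale)
  interpret A: module ?S
    by (rule module_pth_power_scale)
  obtain B where "finite_dimensional_vector_space ?s B"
    using assms by (auto simp: finite_dimensional_def)
  then interpret FK: finite_dimensional_vector_space ?s B .
  have finB: "finite B" and indB: "K.independent B" and spanB: "K.span B = UNIV"
    using FK.finite_Basis FK.independent_Basis FK.span_Basis by auto
  have coeff_eq_0: "u b = 0" if "(\<Sum>b\<in>B. ?s (u b) b) = 0" "b \<in> B" for u b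
    using indB that unfolding K.dependent_finite[OF finB] by auto
  \<comment> \<open>With \<open>0\<close> in \<open>B\<close>, the elements
    \<open>mfps_monom 0 e\<close> would coincide for all \<open>e\<close>, and the indexing of
    \<open>V\<close> would not be injective.\<close>
  have B0: "0 \<notin> B"
    using indB K.dependent_zero by blast
  define E where "E = {e::'n \<Rightarrow> nat. \<forall>i. e i < ?p}"
  have E: "e i < ?p" if "e \<in> E" for e i
    using that by (simp add: E_def)
  have "E = PiE UNIV (\<lambda>i. {..<?p})"
    by (auto simp: E_def PiE_def Pi_def)
  then have finE: "finite E"
    by (simp add: finite_PiE)
  have modE: "(\<lambda>i. m i mod ?p) \<in> E" for m
    by (simp add: E_def CHAR_pos)
  define V where "V = (\<lambda>(b, e). mfps_monom b e) ` (B \<times> E)"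
  have finV: "finite V"
    using finB finE by (simp add: V_def)
  have inj: "inj_on (\<lambda>(b, e). mfps_monom b e) (B \<times> E)"
  proof (rule inj_onI, clarify)
    fix b e b' e'
    assume "b \<in> B" and eq: "mfps_monom b e = mfps_monom b' e'"
    then have "mfps_coeff (mfps_monom b' e') e = b" "b \<noteq> 0"
      using B0 mfps_coeff_monom[of b e e] by auto
    then show "b = b' \<and> e = e'"
      by (auto simp: mfps_coeff_monom split: if_splits)
  qed
  \<comment> \<open>Only the remainder of \<open>m\<close> survives in the sum over
    \<open>E\<close>, which leaves a combination of \<open>B\<close> over the pth powers of
    \<open>K\<close>. Independence and spanning of \<open>V\<close> are both reduced to those of
    \<open>B\<close> by this formula.\<close>
  have coeff_sum: "mfps_coeff (\<Sum>v\<in>V. ?S (pth_power_of (h v)) v) m =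
      (\<Sum>b\<in>B. mfps_coeff (h (mfps_monom b (\<lambda>i. m i mod ?p))) (\<lambda>i. m i div ?p) ^ ?p * b)" for h m
  proof -
    have "(\<Sum>v\<in>V. ?S (pth_power_of (h v)) v) =
        (\<Sum>(b, e)\<in>B \<times> E. h (mfps_monom b e) ^ ?p * mfps_monom b e)"
      unfolding V_def
      by (subst sum.reindex[OF inj]) (simp add: pth_power_scale_def pth_power_of.rep_eq case_prod_unfold)
    also have "\<dots> = (\<Sum>b\<in>B. \<Sum>e\<in>E. h (mfps_monom b e) ^ ?p * mfps_monom b e)"
      by (rule sum.cartesian_product[symmetric])
    finally have "mfps_coeff (\<Sum>v\<in>V. ?S (pth_power_of (h v)) v) m =
        (\<Sum>b\<in>B. \<Sum>e\<in>E. if e = (\<lambda>i. m i mod ?p)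
          then mfps_coeff (h (mfps_monom b e)) (\<lambda>i. m i div ?p) ^ ?p * b else 0)"
      by (simp add: mfps_coeff_sum mfps_coeff_power_CHAR_mult_monom E)
    then show ?thesis
      using modE finE by (simp add: sum.delta)
  qed
  have "A.independent V"
  proof
    assume "A.dependent V"
    then obtain u v0 where v0: "v0 \<in> V" "u v0 \<noteq> 0" and sum0: "(\<Sum>v\<in>V. ?S (u v) v) = 0"
      using A.dependent_finite[OF finV] by auto
    have "\<forall>v. \<exists>a. u v = pth_power_of a"
      using pth_power_of_surj by blast
    then obtain h where h: "u = (\<lambda>v. pth_power_of (h v))"
      by metis
    obtain b e where be: "b \<in> B" "e \<in> E" "v0 = mfps_monom b e"
      using v0 by (auto simp: V_def)
    have "h v0 = 0"
    proof (rule mfps_eqI)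
      fix k
      \<comment> \<open>The exponent with quotient \<open>k\<close> and remainder \<open>e\<close>:
        here \<open>coeff_sum\<close> isolates the coefficients at \<open>k\<close> of the roots
        attached to the monomials with exponent \<open>e\<close>.\<close>
      let ?m = "\<lambda>i. ?p * k i + e i"
      have m: "(\<lambda>i. ?m i mod ?p) = e" "(\<lambda>i. ?m i div ?p) = k"
        using E[OF be(2)] CHAR_pos[where 'a='k] by auto
      have "(\<Sum>b\<in>B. mfps_coeff (h (mfps_monom b e)) k ^ ?p * b) = 0"
        using coeff_sum[of h ?m] sum0 unfolding h m by (simp add: zero_mfps.rep_eq)
      then have "(\<Sum>b\<in>B. ?s (pth_power_of (mfps_coeff (h (mfps_monom b e)) k)) b) = 0"
        by (simp add: pth_power_scale_def pth_power_of.rep_eq)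
      then have "pth_power_of (mfps_coeff (h v0) k) = 0"
        unfolding be(3) using be(1) by (rule coeff_eq_0)
      then have "mfps_coeff (h v0) k ^ ?p = 0"
        by (metis pth_power_of.rep_eq zero_pth_power.rep_eq)
      then show "mfps_coeff (h v0) k = mfps_coeff 0 k"
        by (simp add: zero_mfps.rep_eq)
    qed
    with v0(2) show False
      by (simp add: h)
  qed
  moreover have "f \<in> A.span V" for f
  proof -
    have "\<forall>a. \<exists>r. (\<Sum>b\<in>B. r b ^ ?p * b) = a"
    proof
      fix a
      have "a \<in> range (\<lambda>u. \<Sum>b\<in>B. ?s (u b) b)"
        unfolding K.span_finite[OF finB, symmetric] spanB by simp
      then obtain u where u: "a = (\<Sum>b\<in>B. ?s (u b) b)"
        by blast
      have "\<forall>b. \<exists>r. u b = pth_power_of r"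
        using pth_power_of_surj by blast
      then obtain r where "\<And>b. u b = pth_power_of (r b)"
        by metis
      with u show "\<exists>r. (\<Sum>b\<in>B. r b ^ ?p * b) = a"
        by (auto simp: pth_power_scale_def pth_power_of.rep_eq)
    qed
    then obtain r where r: "\<forall>a. (\<Sum>b\<in>B. r a b ^ ?p * b) = a"
      by (rule choice [THEN exE])
    define w where "w = inv_into (B \<times> E) (\<lambda>(b, e). mfps_monom b e)"
    have w: "w (mfps_monom b e) = (b, e)" if "b \<in> B" "e \<in> E" for b e
      using inv_into_f_f[OF inj, of "(b, e)"] that by (simp add: w_def)
    \<comment> \<open>For \<open>v\<close> equal to \<open>b\<close> times the monomial with
      exponent \<open>e\<close>, the coefficients of \<open>f\<close> in the residue class of
      \<open>e\<close> are expanded in \<open>B\<close>, and the roots of their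
      \<open>b\<close>-coordinates are collected into one series.\<close>
    define h where "h v = Abs_mfps (\<lambda>k. r (mfps_coeff f (\<lambda>i. ?p * k i + snd (w v) i)) (fst (w v)))" for v
    have "(\<Sum>v\<in>V. ?S (pth_power_of (h v)) v) = f"
    proof (rule mfps_eqI)
      fix m
      have "mfps_coeff (\<Sum>v\<in>V. ?S (pth_power_of (h v)) v) m = (\<Sum>b\<in>B. r (mfps_coeff f m) b ^ ?p * b)"
        unfolding coeff_sum by (rule sum.cong) (simp_all add: h_def w modE)
      then show "mfps_coeff (\<Sum>v\<in>V. ?S (pth_power_of (h v)) v) m = mfps_coeff f m"
        by (simp add: r)
    qed
    moreover have "(\<Sum>v\<in>V. ?S (pth_power_of (h v)) v) \<in> A.span V"
      by (intro A.span_sum A.span_scale A.span_base)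
    ultimately show ?thesis
      by simp
  qed
  ultimately show ?thesis
    using A.module_axioms by (auto simp: free_module_def)
qed

section \<open>A basis of the power series ring is finite\<close>

text \<open>
  The series \<open>\<Sum>x\<^sup>i\<^sup>e b\<^sub>i\<close>. For \<open>e \<noteq> 0\<close>, only the indices up to the total degree of \<open>m\<close> contribute
  to the coefficient at \<open>m\<close>.
\<close>

definition monom_series ::
    "('n \<Rightarrow> nat) \<Rightarrow> (nat \<Rightarrow> ('a, 'n) mfps) \<Rightarrow> ('a::comm_ring_1, 'n::finite) mfps" where
  "monom_series e b = Abs_mfps (\<lambda>m. \<Sum>i\<le>sum m UNIV. mfps_coeff (mfps_monom 1 e ^ i * b i) m)"

text \<open>The exponent of variable \<open>j\<close> in the \<open>k\<close>th power is at least
  \<open>k\<close>, which exceeds \<open>m j\<close>.\<close>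

lemma mfps_coeff_monom_power_mult_eq_0:
  fixes f :: "('a::comm_ring_1, 'n::finite) mfps"
  assumes "e j > 0" "k > sum m UNIV"
  shows "mfps_coeff (mfps_monom 1 e ^ k * f) m = 0"
proof -
  have "m j \<le> sum m UNIV"
    by (rule member_le_sum) auto
  with assms have "\<not> k * e j \<le> m j"
    by (metis One_nat_def Suc_leI le_trans mult.right_neutral mult_le_mono2 not_le)
  then show ?thesis
    by (auto simp: mfps_monom_power mfps_coeff_monom_mult le_fun_def)
qed

text \<open>Module coordinates respect only finite sums; peeling off one term at a time makes the
  infinite series accessible to them.\<close>

lemma monom_series_rec:
  fixes b :: "nat \<Rightarrow> ('a::comm_ring_1, 'n::finite) mfps"
  assumes e: "e j > 0"
  shows "monom_series e b = b 0 + mfps_monom 1 e * monom_series e (\<lambda>i. b (Suc i))"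
proof (rule mfps_eqI)
  fix m :: "'n \<Rightarrow> nat"
  let ?t = "mfps_monom 1 e :: ('a, 'n) mfps"
  let ?d = "sum m UNIV"
  let ?T = "\<Sum>i\<le>?d. mfps_coeff (?t ^ Suc i * b (Suc i)) m"
  \<comment> \<open>One vanishing term is appended, so that \<open>Suc ?d\<close> terms remain after
    the term at index \<open>0\<close> is split off.\<close>
  have "mfps_coeff (monom_series e b) m = (\<Sum>i\<le>Suc ?d. mfps_coeff (?t ^ i * b i) m)"
    using mfps_coeff_monom_power_mult_eq_0[of e j m "Suc ?d", OF e] by (simp add: monom_series_def)
  also have "\<dots> = mfps_coeff (b 0) m + ?T"
    by (subst sum.atMost_Suc_shift) simp
  also have "?T = mfps_coeff (?t * monom_series e (\<lambda>i. b (Suc i))) m"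
  proof -
    let ?m = "\<lambda>i. m i - e i"
    have "?T = (if e \<le> m then \<Sum>i\<le>?d. mfps_coeff (?t ^ i * b (Suc i)) ?m else 0)"
      by (simp add: mult.assoc mfps_coeff_monom_mult)
    \<comment> \<open>The terms beyond the total degree of \<open>?m\<close> vanish, so the cutoff
      can be lowered to the one in the definition of the series.\<close>
    also have "(\<Sum>i\<le>?d. mfps_coeff (?t ^ i * b (Suc i)) ?m) =
        (\<Sum>i\<le>sum ?m UNIV. mfps_coeff (?t ^ i * b (Suc i)) ?m)"
    proof (rule sum.mono_neutral_right)
      show "{..sum ?m UNIV} \<subseteq> {..?d}"
        using sum_mono[of UNIV ?m m] by auto
    qed (auto intro: mfps_coeff_monom_power_mult_eq_0[where e = e and j = j, OF e])
    finally show ?thesis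
      by (simp add: mfps_coeff_monom_mult monom_series_def)
  qed
  finally show "mfps_coeff (monom_series e b) m =
      mfps_coeff (b 0 + ?t * monom_series e (\<lambda>i. b (Suc i))) m"
    by (simp add: plus_mfps.rep_eq)
qed

lemma finite_basis_mfps:
  fixes B :: "('k::field_prime_char, 'n::finite) mfps set"
  assumes ind: "\<not> module.dependent pth_power_scale B" and span: "module.span pth_power_scale B = UNIV"
  shows "finite B"
proof (rule ccontr)
  let ?S = "pth_power_scale :: ('k, 'n) mfps pth_power \<Rightarrow> ('k, 'n) mfps \<Rightarrow> ('k, 'n) mfps"
  interpret A: module ?S
    by (rule module_pth_power_scale)
  assume "infinite B"
  then obtain b0 :: "nat \<Rightarrow> ('k, 'n) mfps" where b0: "inj b0" "range b0 \<subseteq> B"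
    using infinite_countable_subset by blast
  define e where "e = (\<lambda>_::'n. CHAR('k))"
  have e0: "e j > 0" for j
    by (simp add: e_def CHAR_pos)
  define t where "t = pth_power_of (mfps_monom 1 (\<lambda>_. 1) :: ('k, 'n) mfps)"
  have t: "of_pth_power t = mfps_monom 1 e"
    by (simp add: t_def e_def pth_power_of.rep_eq mfps_monom_power)
  define s :: "(nat \<Rightarrow> ('k, 'n) mfps) \<Rightarrow> ('k, 'n) mfps" where "s = monom_series e"
  have rec: "s b = b 0 + ?S t (s (\<lambda>i. b (Suc i)))" for b
    unfolding s_def pth_power_scale_def t by (rule monom_series_rec[OF e0])
  have coord: "A.representation B (s b) (b N) =
      A.representation B (b 0) (b N) + t * A.representation B (s (\<lambda>i. b (Suc i))) (b N)" for b N
    by (subst rec) (simp add: A.representation_add A.representation_scale ind span)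
  \<comment> \<open>The sequence is kept arbitrary because the induction step passes to the shifted
    sequence, which \<open>coord\<close> multiplies by \<open>t\<close>.\<close>
  have *: "\<exists>c. A.representation B (s b) (b N) = t ^ N * (1 + t * c)"
    if "inj b" "range b \<subseteq> B" for b N
    using that
  proof (induction N arbitrary: b)
    case 0
    then have "b 0 \<in> B"
      by auto
    then have "A.representation B (b 0) (b 0) = 1"
      using A.representation_basis[OF ind, of "b 0"] by auto
    then show ?case
      by (auto simp: coord)
  next
    case (Suc N)
    have "inj (\<lambda>i. b (Suc i))" "range (\<lambda>i. b (Suc i)) \<subseteq> B"
      using Suc.prems by (auto simp: inj_on_def)
    from Suc.IH[OF this] obtain c where
      "A.representation B (s (\<lambda>i. b (Suc i))) (b (Suc N)) = t ^ N * (1 + t * c)"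
      by auto
    moreover have "A.representation B (b 0) (b (Suc N)) = 0"
    proof -
      have "b 0 \<in> B" "b (Suc N) \<noteq> b 0"
        using Suc.prems by (auto dest: injD)
      then show ?thesis
        using A.representation_basis[OF ind, of "b 0"] by simp
    qed
    ultimately show ?case
      by (auto simp: coord mult.assoc)
  qed
  \<comment> \<open>Since \<open>e\<close> is not zero, the second factor has constant coefficient
    1, which reappears as the coefficient at \<open>N\<close> times \<open>e\<close>.\<close>
  have nonzero: "t ^ N * (1 + t * c) \<noteq> 0" for N c
  proof
    assume "t ^ N * (1 + t * c) = 0"
    then have "of_pth_power (t ^ N * (1 + t * c)) = 0"
      by (simp only: zero_pth_power.rep_eq)
    then have "mfps_monom 1 e ^ N * (1 + mfps_monom 1 e * of_pth_power c) = 0"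
      by (simp only: of_pth_power_power t times_pth_power.rep_eq plus_pth_power.rep_eq
          one_pth_power.rep_eq)
    then have "mfps_coeff (mfps_monom 1 e ^ N * (1 + mfps_monom 1 e * of_pth_power c))
        (\<lambda>i. N * e i) = 0"
      by (simp add: zero_mfps.rep_eq)
    moreover have "\<not> e \<le> (\<lambda>_. 0)"
      using e0 by (auto simp: le_fun_def)
    ultimately show False
      by (simp add: mfps_monom_power mfps_coeff_monom_mult plus_mfps.rep_eq one_mfps.rep_eq)
  qed
  have "A.representation B (s b0) (b0 N) \<noteq> 0" for N
    using *[OF b0, of N] nonzero by auto
  then have "range b0 \<subseteq> {b. A.representation B (s b0) b \<noteq> 0}"
    by auto
  then have "finite (range b0)"
    by (rule finite_subset) (rule A.finite_representation)
  with b0(1) show False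
    using finite_imageD by blast
qed

section \<open>Finite degree of the field from a finite basis of the power series ring\<close>

lemma finite_dimensional_if_free_module_mfps:
  assumes "free_module (pth_power_scale ::
    ('k::field_prime_char, 'n::finite) mfps pth_power \<Rightarrow> ('k, 'n) mfps \<Rightarrow> ('k, 'n) mfps)"
  shows "finite_dimensional (pth_power_scale :: 'k pth_power \<Rightarrow> 'k \<Rightarrow> 'k)"
proof -
  let ?s = "pth_power_scale :: 'k pth_power \<Rightarrow> 'k \<Rightarrow> 'k"
  let ?S = "pth_power_scale :: ('k, 'n) mfps pth_power \<Rightarrow> ('k, 'n) mfps \<Rightarrow> ('k, 'n) mfps"
  interpret K: vector_space ?s
    by (rule vector_space_pth_power_scale)
  interpret A: module ?S
    by (rule module_pth_power_scale)
  obtain B where "A.independent B" and spanB: "A.span B = UNIV"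
    using assms by (auto simp: free_module_def)
  then have finB: "finite B"
    by (rule finite_basis_mfps)
  let ?c = "\<lambda>f :: ('k, 'n) mfps. mfps_coeff f (\<lambda>_. 0)"
  \<comment> \<open>Taking constant coefficients is a surjective ring homomorphism that carries pth
    powers to pth powers, so it turns the expansion of the constant series \<open>a\<close> in
    \<open>B\<close> into one of \<open>a\<close> in the image of \<open>B\<close>.\<close>
  have "a \<in> K.span (?c ` B)" for a
  proof -
    have "mfps_monom a (\<lambda>_. 0) \<in> range (\<lambda>u. \<Sum>b\<in>B. ?S (u b) b)"
      unfolding A.span_finite[OF finB, symmetric] spanB by simp
    then obtain u where u: "mfps_monom a (\<lambda>_. 0) = (\<Sum>b\<in>B. ?S (u b) b)"
      by blast
    have "\<forall>b. \<exists>r. u b = pth_power_of r"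
      using pth_power_of_surj by blast
    then obtain r where r: "\<And>b. u b = pth_power_of (r b)"
      by metis
    have "a = ?c (mfps_monom a (\<lambda>_. 0))"
      by (simp add: mfps_coeff_monom)
    also have "\<dots> = (\<Sum>b\<in>B. ?s (pth_power_of (?c (r b))) (?c b))"
      by (simp add: u r mfps_coeff_sum pth_power_scale_def pth_power_of.rep_eq
          mfps_coeff_mult_zero mfps_coeff_power_zero)
    also have "\<dots> \<in> K.span (?c ` B)"
      by (intro K.span_sum K.span_scale K.span_base imageI)
    finally show ?thesis .
  qed
  then have span_c: "K.span (?c ` B) = UNIV"
    by auto
  \<comment> \<open>The image of \<open>B\<close> spans but may be dependent, so a basis is
    extracted from it.\<close>
  obtain C where C: "C \<subseteq> ?c ` B" "K.independent C" "?c ` B \<subseteq> K.span C"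
    by (rule K.maximal_independent_subset)
  have "finite_dimensional_vector_space ?s C"
  proof unfold_locales
    show "finite C"
      using C(1) finB by (auto intro: finite_subset)
    show "K.independent C"
      by (rule C(2))
    show "K.span C = UNIV"
      using K.span_mono[OF C(3)] span_c by (simp add: K.span_span top.extremum_unique)
  qed
  then show ?thesis
    by (auto simp: finite_dimensional_def)
qed

theorem corollary1p4:
  shows "free_module (pth_power_scale ::
           ('k::field_prime_char, 'n::finite) mfps pth_power \<Rightarrow> ('k, 'n) mfps \<Rightarrow> ('k, 'n) mfps)
     \<longleftrightarrow> finite_dimensional (pth_power_scale :: 'k pth_power \<Rightarrow> 'k \<Rightarrow> 'k)"
  using free_module_mfps_if_finite_dimensional finite_dimensional_if_free_module_mfps by blast

end
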